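(* Let $n$ be a positive integer and $x,y,z\in\mathbb{R}$, and let $P_n$ denote the simple path with $n$ vertices. Put $D := x^2+2xy+y^2+4z$. If $z > -\left(\frac{x+y}{2}\right)^2$, then \[ \xi(P_n;x,y,z) = \frac{\sqrt{D}-x+y}{2\sqrt{D}} \left( \frac{x+y-\sqrt{D}}{2}\right)^n + \frac{\sqrt{D}+x-y}{2\sqrt{D}}\left( \frac{x+y+\sqrt{D}}{2}\right)^n . \] If $z < -\left(\frac{x+y}{2}\right)^2$, then \[ \xi(P_n;x,y,z) = (-z)^{n/2} \left( \cos(n\varphi) + \frac{x-y}{\sqrt{-D}} \sin(n\varphi)\right), \] where \[ \varphi = \begin{cases} \arctan \frac{\sqrt{-D}}{x+y} & \text{if } x+y > 0, \\ \pi/2 & \text{if } x+y=0, \\ \pi+\arctan \frac{\sqrt{-D}}{x+y} & \text{if } x+y < 0. \end{cases} \] If $z = -\left(\frac{x+y}{2}\right)^2$, then \[ \xi(P_n;x,y,z) = \frac{(n+1)x - (n-1)y}{2}\left( \frac{x+y}{2} \right)^{n-1}. \]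
   Context: All graphs are finite and undirected and may have loops and multiple edges. For a graph $G$ and an edge $e$: $G_{-e}$ is the graph obtained by removing $e$; $G_{/e}$ is the graph obtained by removing $e$ and identifying its endpoints; $G_{\dagger e}$ is the graph obtained by removing $e$ and all vertices incident with $e$. $P_n$ denotes the simple path with $n$ vertices ($n=0,1,\dots$; $P_0$ is the empty graph) and $\oplus$ denotes disjoint union. The universal edge elimination polynomial $\xi(G;x,y,z)$ (of Averbouch, Godlin and Makowsky) is defined by $\xi(P_0;x,y,z)=1$, $\xi(P_1;x,y,z)=x$, $\xi(G;x,y,z) = \xi(G_{-e};x,y,z) + y\,\xi(G_{/e};x,y,z) + z\,\xi(G_{\dagger e};x,y,z)$ for every edge $e$ of $G$, and $\xi(G_1\oplus G_2;x,y,z)=\xi(G_1;x,y,z)\,\xi(G_2;x,y,z)$. *)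

theory Defs
  imports Complex_Main "HOL-Library.Multiset" "HOL-Library.Uprod"
begin

section \<open>Finite multigraphs\<close>

text \<open>
  A finite undirected graph with loops and multiple edges is a finite set of vertices together
  with a finite multiset of unordered pairs of vertices: the multiplicity of a pair is the number
  of parallel edges, and \<open>Upair v v\<close> is a loop. The vertices are natural numbers; every
  finite graph is isomorphic to one of this kind.
\<close>

record graph =
  verts :: "nat set"
  edges :: "nat uprod multiset"

definition wf_graph :: "graph \<Rightarrow> bool" where
  "wf_graph G \<longleftrightarrow> finite (verts G) \<and> (\<forall>e\<in>#edges G. set_uprod e \<subseteq> verts G)"

definition graph_iso :: "graph \<Rightarrow> graph \<Rightarrow> bool" (infix "\<cong>\<^sub>g" 50) where
  "G \<cong>\<^sub>g H \<longleftrightarrow> (\<exists>f. bij_betw f (verts G) (verts H) \<and> edges H = image_mset (map_uprod f) (edges G))"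

definition del_edge :: "graph \<Rightarrow> nat uprod \<Rightarrow> graph" where
  "del_edge G e = \<lparr>verts = verts G, edges = edges G - {#e#}\<rparr>"

text \<open>The two endpoints of the contracted edge are both renamed to the smaller one.\<close>

definition merge :: "nat uprod \<Rightarrow> nat \<Rightarrow> nat" where
  "merge e v = (if v \<in> set_uprod e then Min (set_uprod e) else v)"

definition contract_edge :: "graph \<Rightarrow> nat uprod \<Rightarrow> graph" where
  "contract_edge G e =
     \<lparr>verts = merge e ` verts G, edges = image_mset (map_uprod (merge e)) (edges G - {#e#})\<rparr>"

text \<open>
  Removing the endpoints of \<open>e\<close> also removes all edges that meet them, among them \<open>e\<close>
  and the edges parallel to it.
\<close>

definition extract_edge :: "graph \<Rightarrow> nat uprod \<Rightarrow> graph" where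
  "extract_edge G e =
     \<lparr>verts = verts G - set_uprod e,
      edges = filter_mset (\<lambda>f. set_uprod f \<inter> set_uprod e = {}) (edges G)\<rparr>"

text \<open>This is the disjoint union if the vertex sets are disjoint.\<close>

definition graph_union :: "graph \<Rightarrow> graph \<Rightarrow> graph" where
  "graph_union G H = \<lparr>verts = verts G \<union> verts H, edges = edges G + edges H\<rparr>"

definition path_graph :: "nat \<Rightarrow> graph" where
  "path_graph n =
     \<lparr>verts = {..<n}, edges = image_mset (\<lambda>i. Upair i (Suc i)) (mset_set {..<n - 1})\<rparr>"

section \<open>The universal edge elimination polynomial\<close>

definition edge_elimination :: "real \<Rightarrow> real \<Rightarrow> real \<Rightarrow> (graph \<Rightarrow> real) \<Rightarrow> bool" where
  "edge_elimination x y z f \<longleftrightarrow>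
     (\<forall>G H. wf_graph G \<longrightarrow> wf_graph H \<longrightarrow> G \<cong>\<^sub>g H \<longrightarrow> f G = f H) \<and>
     f (path_graph 0) = 1 \<and>
     f (path_graph 1) = x \<and>
     (\<forall>G e. wf_graph G \<longrightarrow> e \<in># edges G \<longrightarrow>
        f G = f (del_edge G e) + y * f (contract_edge G e) + z * f (extract_edge G e)) \<and>
     (\<forall>G H. wf_graph G \<longrightarrow> wf_graph H \<longrightarrow> verts G \<inter> verts H = {} \<longrightarrow>
        f (graph_union G H) = f G * f H)"

text \<open>
  The polynomial is the graph invariant determined by these rules. The value 0 on records that
  are not graphs only serves to make the function unique; existence and uniqueness are shown below.
\<close>

definition \<xi> :: "graph \<Rightarrow> real \<Rightarrow> real \<Rightarrow> real \<Rightarrow> real" where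
  "\<xi> G x y z = (THE f. edge_elimination x y z f \<and> (\<forall>H. \<not> wf_graph H \<longrightarrow> f H = 0)) G"

section \<open>Existence and uniqueness\<close>

lemma set_uprod_nonempty [simp]: "set_uprod e \<noteq> {}"
  by (cases e) auto

lemma map_uprod_ident_set: "(\<And>v. v \<in> set_uprod e \<Longrightarrow> f v = v) \<Longrightarrow> map_uprod f e = e"
  by (cases e) auto

lemma Min_set_uprod_in [simp]: "Min (set_uprod e) \<in> set_uprod e"
  by (rule Min_in) auto

lemma size_del [simp]: "e \<in># edges G \<Longrightarrow> size (edges (del_edge G e)) < size (edges G)"
  by (simp add: del_edge_def size_Diff1_less)

lemma size_contract [simp]: "e \<in># edges G \<Longrightarrow> size (edges (contract_edge G e)) < size (edges G)"
  by (simp add: contract_edge_def size_Diff1_less)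

lemma size_extract [simp]: "e \<in># edges G \<Longrightarrow> size (edges (extract_edge G e)) < size (edges G)"
proof -
  assume e: "e \<in># edges G"
  have "filter_mset (\<lambda>f. set_uprod f \<inter> set_uprod e = {}) (edges G) \<subset># edges G"
    using e by (metis (mono_tags, lifting) filter_mset_eq_conv inf.idem multiset_filter_subset
        set_uprod_nonempty subset_mset.le_neq_trans mem_Collect_eq set_mset_filter)
  then show ?thesis
    by (simp add: extract_edge_def mset_subset_size)
qed

lemma wf_del: "wf_graph G \<Longrightarrow> wf_graph (del_edge G e)"
  by (auto simp: wf_graph_def del_edge_def dest: in_diffD)

lemma wf_contract: "wf_graph G \<Longrightarrow> wf_graph (contract_edge G e)"
  by (fastforce simp: wf_graph_def contract_edge_def uprod.set_map dest: in_diffD)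

lemma wf_extract: "wf_graph G \<Longrightarrow> wf_graph (extract_edge G e)"
  by (auto simp: wf_graph_def extract_edge_def)

lemma wf_union: "wf_graph G \<Longrightarrow> wf_graph H \<Longrightarrow> wf_graph (graph_union G H)"
  by (auto simp: wf_graph_def graph_union_def)

text \<open>Existence: expand along an arbitrarily chosen edge; the result does not depend on the choice.\<close>

function elim_rec :: "real \<Rightarrow> real \<Rightarrow> real \<Rightarrow> graph \<Rightarrow> real" where
  "elim_rec x y z G =
     (if edges G = {#} then x ^ card (verts G)
      else let e = (SOME e. e \<in># edges G) in
        elim_rec x y z (del_edge G e) + y * elim_rec x y z (contract_edge G e)
          + z * elim_rec x y z (extract_edge G e))"
  by pat_completeness auto
termination
proof (relation "measure (\<lambda>(x, y, z, G). size (edges G))", goal_cases)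
  case (2 x y z G e)
  then have "e \<in># edges G" by (metis multiset_nonemptyE someI_ex)
  then show ?case by simp
next
  case (3 x y z G e)
  then have "e \<in># edges G" by (metis multiset_nonemptyE someI_ex)
  then show ?case by simp
next
  case (4 x y z G e)
  then have "e \<in># edges G" by (metis multiset_nonemptyE someI_ex)
  then show ?case by simp
qed simp

declare elim_rec.simps [simp del]

lemma elim_rec_empty: "edges G = {#} \<Longrightarrow> elim_rec x y z G = x ^ card (verts G)"
  by (simp add: elim_rec.simps)

lemma merge_merge:
  "merge (map_uprod (merge e) e') (merge e v) = merge (map_uprod (merge e') e) (merge e' v)"
  by (cases e; cases e') (auto simp: merge_def min_def)

lemma del_del: "del_edge (del_edge G e) e' = del_edge (del_edge G e') e"
  by (simp add: del_edge_def add_mset_commute)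

lemma contract_del:
  assumes "e \<in># edges G" "e' \<in># edges G" "e \<noteq> e'"
  shows "contract_edge (del_edge G e) e' = del_edge (contract_edge G e') (map_uprod (merge e') e)"
proof -
  from assms obtain M where "edges G = add_mset e (add_mset e' M)"
    by (metis insert_DiffM insert_noteq_member)
  then show ?thesis by (simp add: contract_edge_def del_edge_def)
qed

lemma contract_contract:
  assumes "e \<in># edges G" "e' \<in># edges G" "e \<noteq> e'"
  shows "contract_edge (contract_edge G e) (map_uprod (merge e) e') =
         contract_edge (contract_edge G e') (map_uprod (merge e') e)"
proof -
  from assms obtain M where "edges G = add_mset e (add_mset e' M)"
    by (metis insert_DiffM insert_noteq_member)
  then show ?thesis using assms
    by (simp add: contract_edge_def image_image merge_merge[of e e'] image_mset.compositionality
        uprod.map_comp o_def)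
qed

lemma extract_del_inc:
  assumes "set_uprod e \<inter> set_uprod e' \<noteq> {}"
  shows "extract_edge (del_edge G e) e' = extract_edge G e'"
  using assms by (auto simp: extract_edge_def del_edge_def filter_diff_mset)

lemma extract_del:
  assumes "set_uprod e \<inter> set_uprod e' = {}"
  shows "extract_edge (del_edge G e) e' = del_edge (extract_edge G e') e"
  using assms by (auto simp: extract_edge_def del_edge_def filter_diff_mset)

lemma merge_other: "v \<notin> set_uprod e \<Longrightarrow> merge e v = v"
  by (simp add: merge_def)

lemma merge_meets_inc:
  assumes "set_uprod e \<inter> set_uprod e' \<noteq> {}"
  shows "merge e v \<in> merge e ` set_uprod e' \<longleftrightarrow> v \<in> set_uprod e \<union> set_uprod e'"
  using assms by (cases e; cases e') (auto simp: merge_def min_def)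

lemma extract_contract_inc:
  assumes "set_uprod e \<inter> set_uprod e' \<noteq> {}"
  shows "extract_edge (contract_edge G e) (map_uprod (merge e) e') =
    \<lparr>verts = verts G - (set_uprod e \<union> set_uprod e'),
     edges = filter_mset (\<lambda>f. set_uprod f \<inter> (set_uprod e \<union> set_uprod e') = {}) (edges G)\<rparr>"
proof -
  note m = merge_meets_inc[OF assms]
  have 1: "merge e ` verts G - merge e ` set_uprod e' = verts G - (set_uprod e \<union> set_uprod e')"
    using m merge_other by (auto simp: image_iff) (metis m UnI1 UnI2 imageI)+
  have 2: "set_uprod (map_uprod (merge e) f) \<inter> merge e ` set_uprod e' = {} \<longleftrightarrow>
     set_uprod f \<inter> (set_uprod e \<union> set_uprod e') = {}" for f
    using m by (auto simp: uprod.set_map)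
  have 3: "image_mset (map_uprod (merge e))
      (filter_mset (\<lambda>f. set_uprod f \<inter> (set_uprod e \<union> set_uprod e') = {}) M) =
      filter_mset (\<lambda>f. set_uprod f \<inter> (set_uprod e \<union> set_uprod e') = {}) M" for M
    by (induction M) (auto intro!: map_uprod_ident_set merge_other)
  show ?thesis
    by (simp add: extract_edge_def contract_edge_def uprod.set_map[of _ e'] 1 filter_mset_image_mset
        2 3 filter_diff_mset)
qed

lemma extract_contract:
  assumes "set_uprod e \<inter> set_uprod e' = {}"
  shows "extract_edge (contract_edge G e) e' = contract_edge (extract_edge G e') e"
proof -
  have m: "merge e v \<in> set_uprod e' \<longleftrightarrow> v \<in> set_uprod e'" for v
    using assms by (cases e; cases e') (auto simp: merge_def min_def)
  have 1: "merge e ` verts G - set_uprod e' = merge e ` (verts G - set_uprod e')"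
    using m by auto
  have 2: "set_uprod (map_uprod (merge e) f) \<inter> set_uprod e' = {} \<longleftrightarrow>
     set_uprod f \<inter> set_uprod e' = {}" for f
    using m by (auto simp: uprod.set_map)
  show ?thesis using assms
    by (simp add: extract_edge_def contract_edge_def 1 filter_mset_image_mset 2 filter_diff_mset)
qed

lemma extract_extract: "extract_edge (extract_edge G e) e' = extract_edge (extract_edge G e') e"
  by (auto simp: extract_edge_def filter_filter_mset conj_commute)

lemma merge_disj:
  assumes "set_uprod e \<inter> set_uprod e' = {}"
  shows "map_uprod (merge e) e' = e'"
  using assms by (intro map_uprod_ident_set merge_other) auto

lemma elim_rec_edge:
  "e \<in># edges G \<Longrightarrow> elim_rec x y z G = elim_rec x y z (del_edge G e)
     + y * elim_rec x y z (contract_edge G e) + z * elim_rec x y z (extract_edge G e)"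
proof (induction "size (edges G)" arbitrary: G e rule: less_induct)
  case less
  let ?r = "elim_rec x y z"
  define d where "d = (SOME e. e \<in># edges G)"
  have ne: "edges G \<noteq> {#}" using less.prems by auto
  then have d: "d \<in># edges G" unfolding d_def by (metis multiset_nonemptyE someI_ex)
  have rd: "?r G = ?r (del_edge G d) + y * ?r (contract_edge G d) + z * ?r (extract_edge G d)"
    using ne by (subst elim_rec.simps) (simp add: d_def Let_def)
  show ?case
  proof (cases "d = e")
    case True
    then show ?thesis using rd by simp
  next
    case False
    note e = less.prems
    have m: "b \<in># edges (del_edge G a)" "map_uprod (merge a) b \<in># edges (contract_edge G a)"
      if "a \<noteq> b" "b \<in># edges G" for a b
    proof -
      have "b \<in># edges G - {#a#}"
        using that by (simp add: in_diff_count)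
      then show "b \<in># edges (del_edge G a)" "map_uprod (merge a) b \<in># edges (contract_edge G a)"
        by (auto simp: del_edge_def contract_edge_def)
    qed
    have D: "?r (del_edge G a) = ?r (del_edge (del_edge G a) b)
        + y * ?r (contract_edge (del_edge G a) b) + z * ?r (extract_edge (del_edge G a) b)"
      if "a \<noteq> b" "a \<in># edges G" "b \<in># edges G" for a b
      by (rule less.hyps[OF size_del[OF that(2)] m(1)[OF that(1,3)]])
    have C: "?r (contract_edge G a) = ?r (del_edge (contract_edge G a) (map_uprod (merge a) b))
        + y * ?r (contract_edge (contract_edge G a) (map_uprod (merge a) b))
        + z * ?r (extract_edge (contract_edge G a) (map_uprod (merge a) b))"
      if "a \<noteq> b" "a \<in># edges G" "b \<in># edges G" for a b
      by (rule less.hyps[OF size_contract[OF that(2)] m(2)[OF that(1,3)]])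
    show ?thesis
    proof (cases "set_uprod d \<inter> set_uprod e = {}")
      case True
      then have T: "set_uprod e \<inter> set_uprod d = {}" by auto
      have X: "?r (extract_edge G a) = ?r (del_edge (extract_edge G a) b)
        + y * ?r (contract_edge (extract_edge G a) b) + z * ?r (extract_edge (extract_edge G a) b)"
        if "set_uprod b \<inter> set_uprod a = {}" "a \<in># edges G" "b \<in># edges G" for a b
        by (rule less.hyps[OF size_extract[OF that(2)]]) (simp add: extract_edge_def that)
      have 1: "?r (del_edge G d) = ?r (del_edge (del_edge G e) d)
          + y * ?r (del_edge (contract_edge G e) d) + z * ?r (del_edge (extract_edge G e) d)"
        using D[OF False d e] contract_del[OF d e False]
        by (simp only: del_del[of G d e] merge_disj[OF T] extract_del[OF True])
      have 2: "?r (contract_edge G d) = ?r (contract_edge (del_edge G e) d)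
          + y * ?r (contract_edge (contract_edge G e) d) + z * ?r (contract_edge (extract_edge G e) d)"
        using C[OF False d e] contract_del[OF e d False[symmetric]] contract_contract[OF d e False]
        by (simp only: merge_disj[OF T] merge_disj[OF True] extract_contract[OF True])
      have 3: "?r (extract_edge G d) = ?r (extract_edge (del_edge G e) d)
          + y * ?r (extract_edge (contract_edge G e) d) + z * ?r (extract_edge (extract_edge G e) d)"
        using X[OF T d e]
        by (simp only: extract_del[OF T] extract_contract[OF T] extract_extract[of G d e])
      have 4: "?r (del_edge G e) = ?r (del_edge (del_edge G e) d)
          + y * ?r (contract_edge (del_edge G e) d) + z * ?r (extract_edge (del_edge G e) d)"
        using False by (intro D[OF _ e d]) simp
      have 5: "?r (contract_edge G e) = ?r (del_edge (contract_edge G e) d)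
          + y * ?r (contract_edge (contract_edge G e) d) + z * ?r (extract_edge (contract_edge G e) d)"
        using C[OF False[symmetric] e d] by (simp only: merge_disj[OF T])
      have 6: "?r (extract_edge G e) = ?r (del_edge (extract_edge G e) d)
          + y * ?r (contract_edge (extract_edge G e) d) + z * ?r (extract_edge (extract_edge G e) d)"
        using X[OF True e d] .
      show ?thesis
        unfolding rd 1 2 3 4 5 6 by (simp add: algebra_simps)
    next
      case F: False
      then have F': "set_uprod e \<inter> set_uprod d \<noteq> {}" by auto
      let ?ed = "map_uprod (merge e) d" and ?de = "map_uprod (merge d) e"
      have 1: "?r (del_edge G d) = ?r (del_edge (del_edge G e) d)
          + y * ?r (del_edge (contract_edge G e) ?ed) + z * ?r (extract_edge G e)"
        using D[OF False d e] contract_del[OF d e False]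
        by (simp only: del_del[of G d e] extract_del_inc[OF F])
      have 2: "?r (contract_edge G d) = ?r (contract_edge (del_edge G e) d)
          + y * ?r (contract_edge (contract_edge G e) ?ed) + z * ?r (extract_edge (contract_edge G e) ?ed)"
        using C[OF False d e] contract_del[OF e d False[symmetric]] contract_contract[OF d e False]
        by (simp only: extract_contract_inc[OF F] extract_contract_inc[OF F'] Un_commute[of "set_uprod d" "set_uprod e"])
      have 3: "?r (del_edge G e) = ?r (del_edge (del_edge G e) d)
          + y * ?r (contract_edge (del_edge G e) d) + z * ?r (extract_edge G d)"
        using D[OF False[symmetric] e d] by (simp only: extract_del_inc[OF F'])
      have 4: "?r (contract_edge G e) = ?r (del_edge (contract_edge G e) ?ed)
          + y * ?r (contract_edge (contract_edge G e) ?ed) + z * ?r (extract_edge (contract_edge G e) ?ed)"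
        using C[OF False[symmetric] e d] .
      show ?thesis
        unfolding rd 1 2 3 4 by (simp add: algebra_simps)
    qed
  qed
qed

lemma graph_union_commute: "graph_union G H = graph_union H G"
  by (simp add: graph_union_def Un_commute add.commute)

lemma del_union: "e \<in># edges G \<Longrightarrow> del_edge (graph_union G H) e = graph_union (del_edge G e) H"
  by (simp add: del_edge_def graph_union_def)

lemma contract_union:
  assumes "e \<in># edges G" "wf_graph G" "wf_graph H" "verts G \<inter> verts H = {}"
  shows "contract_edge (graph_union G H) e = graph_union (contract_edge G e) H"
proof -
  have e: "set_uprod e \<inter> verts H = {}" using assms by (auto simp: wf_graph_def)
  then have "merge e ` verts H = verts H" by (auto simp: merge_def image_iff)
  moreover have "image_mset (map_uprod (merge e)) (edges H) = image_mset id (edges H)"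
    using e assms(3) unfolding wf_graph_def
    by (intro image_mset_cong) (auto intro!: map_uprod_ident_set merge_other)
  moreover obtain M where "edges G = add_mset e M"
    using assms(1) by (metis insert_DiffM)
  ultimately show ?thesis
    by (simp add: contract_edge_def graph_union_def image_Un)
qed

lemma extract_union:
  assumes "e \<in># edges G" "wf_graph G" "wf_graph H" "verts G \<inter> verts H = {}"
  shows "extract_edge (graph_union G H) e = graph_union (extract_edge G e) H"
proof -
  have e: "set_uprod e \<inter> verts H = {}" using assms by (auto simp: wf_graph_def)
  then have "filter_mset (\<lambda>f. set_uprod f \<inter> set_uprod e = {}) (edges H) = edges H"
    using assms(3) by (auto simp: wf_graph_def filter_mset_eq_conv)
  then show ?thesis
    using e by (auto simp: extract_edge_def graph_union_def)
qed

lemma verts_ops: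
  assumes "e \<in># edges G" "wf_graph G"
  shows "verts (del_edge G e) \<subseteq> verts G" "verts (contract_edge G e) \<subseteq> verts G"
    "verts (extract_edge G e) \<subseteq> verts G"
  using assms subsetD[OF _ Min_set_uprod_in[of e], of "verts G"]
  by (auto simp: del_edge_def contract_edge_def extract_edge_def wf_graph_def merge_def)

lemma elim_rec_union:
  assumes "wf_graph G" "wf_graph H" "verts G \<inter> verts H = {}"
  shows "elim_rec x y z (graph_union G H) = elim_rec x y z G * elim_rec x y z H"
  using assms
proof (induction "size (edges G) + size (edges H)" arbitrary: G H rule: less_induct)
  case less
  have step: "elim_rec x y z (graph_union A B) = elim_rec x y z A * elim_rec x y z B"
    if e: "e \<in># edges A" and wf: "wf_graph A" "wf_graph B" and dj: "verts A \<inter> verts B = {}"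
      and sz: "size (edges A) + size (edges B) = size (edges G) + size (edges H)" for A B e
  proof -
    have IH: "elim_rec x y z (graph_union A' B) = elim_rec x y z A' * elim_rec x y z B"
      if "size (edges A') < size (edges A)" "wf_graph A'" "verts A' \<subseteq> verts A" for A'
      using that wf dj sz by (intro less.hyps) auto
    have "e \<in># edges (graph_union A B)" using e by (simp add: graph_union_def)
    from elim_rec_edge[OF this] show ?thesis
      using e wf dj verts_ops[OF e wf(1)]
      by (simp add: del_union contract_union extract_union IH wf_del wf_contract wf_extract
          elim_rec_edge[OF e] algebra_simps)
  qed
  consider e where "e \<in># edges G" | e where "e \<in># edges H" | "edges G = {#}" "edges H = {#}"
    by (meson multiset_nonemptyE)
  then show ?case
  proof cases
    case (1 e)
    then show ?thesis using step less.prems by blast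
  next
    case (2 e)
    then have "elim_rec x y z (graph_union H G) = elim_rec x y z H * elim_rec x y z G"
      using less.prems by (intro step) auto
    then show ?thesis by (simp add: graph_union_commute mult.commute)
  next
    case 3
    have "finite (verts G)" "finite (verts H)" using less.prems by (auto simp: wf_graph_def)
    then show ?thesis
      using 3 less.prems(3) by (simp add: elim_rec_empty graph_union_def card_Un_disjoint power_add)
  qed
qed

lemma iso_del:
  assumes "bij_betw f (verts G) (verts H)" "edges H = image_mset (map_uprod f) (edges G)"
    "e \<in># edges G"
  shows "del_edge G e \<cong>\<^sub>g del_edge H (map_uprod f e)"
  using assms unfolding graph_iso_def
  by (intro exI[of _ f]) (simp add: del_edge_def image_mset_Diff)

lemma iso_extract:
  assumes f: "bij_betw f (verts G) (verts H)" and H: "edges H = image_mset (map_uprod f) (edges G)"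
    and e: "e \<in># edges G" and wf: "wf_graph G"
  shows "extract_edge G e \<cong>\<^sub>g extract_edge H (map_uprod f e)"
proof -
  have inj: "inj_on f (verts G)" and im: "f ` verts G = verts H"
    using f by (auto simp: bij_betw_def)
  have sub: "set_uprod h \<subseteq> verts G" if "h \<in># edges G" for h using wf that by (auto simp: wf_graph_def)
  have "bij_betw f (verts G - set_uprod e) (verts H - f ` set_uprod e)"
    using f sub[OF e] inj im by (metis Diff_subset bij_betw_def inj_on_image_set_diff inj_on_subset)
  moreover have "f ` set_uprod h \<inter> f ` set_uprod e = {} \<longleftrightarrow> set_uprod h \<inter> set_uprod e = {}"
    if "h \<in># edges G" for h
    using inj_on_image_Int[OF inj sub[OF that] sub[OF e]] by (metis image_is_empty)
  ultimately show ?thesis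
    unfolding graph_iso_def
    by (intro exI[of _ f])
      (simp add: extract_edge_def H uprod.set_map filter_mset_image_mset cong: filter_mset_cong)
qed

lemma iso_contract:
  assumes f: "bij_betw f (verts G) (verts H)" and H: "edges H = image_mset (map_uprod f) (edges G)"
    and e: "e \<in># edges G" and wf: "wf_graph G"
  shows "contract_edge G e \<cong>\<^sub>g contract_edge H (map_uprod f e)"
proof -
  let ?e' = "map_uprod f e"
  let ?g = "\<lambda>v. merge ?e' (f v)"
  have inj: "inj_on f (verts G)" and im: "f ` verts G = verts H"
    using f by (auto simp: bij_betw_def)
  have sub: "set_uprod h \<subseteq> verts G" if "h \<in># edges G" for h using wf that by (auto simp: wf_graph_def)
  have mem: "f v \<in> set_uprod ?e' \<longleftrightarrow> v \<in> set_uprod e" if "v \<in> verts G" for v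
    using that inj sub[OF e] by (simp add: uprod.set_map inj_on_image_mem_iff)
  have mV: "merge e v \<in> verts G" if "v \<in> verts G" for v
    using that sub[OF e] Min_set_uprod_in[of e] by (auto simp: merge_def)
  have g: "?g (merge e v) = ?g v" if "v \<in> verts G" for v
    using that mem[OF that] mem[OF mV[OF that]] by (auto simp: merge_def)
  have g2: "?g u = ?g v \<longleftrightarrow> merge e u = merge e v" if "u \<in> verts G" "v \<in> verts G" for u v
  proof -
    have "f u = f v \<longleftrightarrow> u = v" using inj that by (meson inj_on_eq_iff)
    moreover have "Min (set_uprod e) \<noteq> u" "u \<noteq> Min (set_uprod e)" if "u \<notin> set_uprod e"
      using that Min_set_uprod_in[of e] by metis+
    moreover have "Min (set_uprod e) \<noteq> v" "v \<noteq> Min (set_uprod e)" if "v \<notin> set_uprod e"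
      using that Min_set_uprod_in[of e] by metis+
    moreover have "Min (set_uprod ?e') \<noteq> f u" "f u \<noteq> Min (set_uprod ?e')" if "u \<notin> set_uprod e"
      using that Min_set_uprod_in[of ?e'] mem[OF \<open>u \<in> verts G\<close>] by metis+
    moreover have "Min (set_uprod ?e') \<noteq> f v" "f v \<noteq> Min (set_uprod ?e')" if "v \<notin> set_uprod e"
      using that Min_set_uprod_in[of ?e'] mem[OF \<open>v \<in> verts G\<close>] by metis+
    ultimately show ?thesis
      using mem[OF that(1)] mem[OF that(2)] unfolding merge_def
      by (cases "u \<in> set_uprod e"; cases "v \<in> set_uprod e") simp_all
  qed
  have "bij_betw ?g (merge e ` verts G) (merge ?e' ` verts H)"
    unfolding bij_betw_def
  proof
    show "inj_on ?g (merge e ` verts G)"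
      by (auto simp: inj_on_def g g2)
    show "?g ` merge e ` verts G = merge ?e' ` verts H"
      unfolding im[symmetric] image_image by (intro image_cong refl g)
  qed
  moreover have "image_mset (map_uprod (merge ?e')) (edges H - {#?e'#}) =
     image_mset (map_uprod ?g) (image_mset (map_uprod (merge e)) (edges G - {#e#}))"
  proof -
    have H': "edges H - {#?e'#} = image_mset (map_uprod f) (edges G - {#e#})"
      using e by (simp add: H image_mset_Diff)
    have "map_uprod (merge ?e') (map_uprod f h) = map_uprod ?g (map_uprod (merge e) h)"
      if "h \<in># edges G - {#e#}" for h
      using g sub[OF in_diffD[OF that]] unfolding uprod.map_comp
      by (intro uprod.map_cong0) auto
    then show ?thesis
      unfolding H' image_mset.compositionality o_def by (rule image_mset_cong)
  qed
  ultimately show ?thesis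
    unfolding graph_iso_def by (intro exI[of _ ?g]) (simp add: contract_edge_def)
qed

lemma elim_rec_iso:
  assumes "wf_graph G" "wf_graph H" "G \<cong>\<^sub>g H"
  shows "elim_rec x y z G = elim_rec x y z H"
  using assms
proof (induction "size (edges G)" arbitrary: G H rule: less_induct)
  case less
  from less.prems(3) obtain f where f: "bij_betw f (verts G) (verts H)"
    and H: "edges H = image_mset (map_uprod f) (edges G)" by (auto simp: graph_iso_def)
  show ?case
  proof (cases "edges G = {#}")
    case True
    then show ?thesis using bij_betw_same_card[OF f] H by (simp add: elim_rec_empty)
  next
    case False
    then obtain e where e: "e \<in># edges G" by (meson multiset_nonemptyE)
    then have e': "map_uprod f e \<in># edges H" using H by simp
    note wf = less.prems(1,2)
    show ?thesis
      unfolding elim_rec_edge[OF e] elim_rec_edge[OF e']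
      using less.hyps[OF size_del[OF e] wf_del wf_del iso_del[OF f H e]]
        less.hyps[OF size_contract[OF e] wf_contract wf_contract iso_contract[OF f H e]]
        less.hyps[OF size_extract[OF e] wf_extract wf_extract iso_extract[OF f H e]] wf
      by simp
  qed
qed

lemma edge_elimination_elim_rec: "edge_elimination x y z (elim_rec x y z)"
  unfolding edge_elimination_def
  using elim_rec_iso elim_rec_edge elim_rec_union
  by (auto simp: elim_rec_empty path_graph_def)

lemma edge_elimination_unique:
  assumes f: "edge_elimination x y z f" and "wf_graph G"
  shows "f G = elim_rec x y z G"
  using assms(2)
proof (induction "size (edges G)" arbitrary: G rule: less_induct)
  case less
  show ?case
  proof (cases "edges G = {#}")
    case False
    then obtain e where e: "e \<in># edges G" by (meson multiset_nonemptyE)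
    have "f G = f (del_edge G e) + y * f (contract_edge G e) + z * f (extract_edge G e)"
      using f less.prems e unfolding edge_elimination_def by blast
    then show ?thesis
      using e less.prems by (simp add: elim_rec_edge[OF e] less.hyps wf_del wf_contract wf_extract)
  next
    case True
    have edgeless: "f \<lparr>verts = V, edges = {#}\<rparr> = x ^ card V" if "finite V" for V
      using that
    proof (induction V rule: finite_induct)
      case empty
      then show ?case using f by (simp add: edge_elimination_def path_graph_def)
    next
      case (insert v V)
      let ?A = "\<lparr>verts = {v}, edges = {#}\<rparr>" and ?B = "\<lparr>verts = V, edges = {#}\<rparr>"
      have wf: "wf_graph ?A" "wf_graph ?B" "wf_graph (path_graph 1)"
        using insert by (auto simp: wf_graph_def path_graph_def)
      have "?A \<cong>\<^sub>g path_graph 1"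
        by (auto simp: graph_iso_def path_graph_def bij_betw_def intro!: exI[of _ "\<lambda>_. 0"])
      then have A: "f ?A = x"
        using f wf unfolding edge_elimination_def by metis
      have "verts ?A \<inter> verts ?B = {}" using insert by simp
      then have "f (graph_union ?A ?B) = f ?A * f ?B"
        using f wf unfolding edge_elimination_def by blast
      then show ?case using insert A by (simp add: graph_union_def)
    qed
    have G: "G = \<lparr>verts = verts G, edges = {#}\<rparr>" using True by simp
    have "f G = x ^ card (verts G)"
      using edgeless[of "verts G"] less.prems G unfolding wf_graph_def by metis
    then show ?thesis using True by (simp add: elim_rec_empty)
  qed
qed

lemma edge_elimination_ex1:
  "\<exists>!f. edge_elimination x y z f \<and> (\<forall>H. \<not> wf_graph H \<longrightarrow> f H = 0)"
proof
  let ?f = "\<lambda>G. if wf_graph G then elim_rec x y z G else 0"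
  have "wf_graph (path_graph 0)" "wf_graph (path_graph 1)"
    by (auto simp: wf_graph_def path_graph_def)
  then show "edge_elimination x y z ?f \<and> (\<forall>H. \<not> wf_graph H \<longrightarrow> ?f H = 0)"
    using edge_elimination_elim_rec[of x y z] unfolding edge_elimination_def
    by (simp add: wf_del wf_contract wf_extract wf_union)
  show "f = ?f" if "edge_elimination x y z f \<and> (\<forall>H. \<not> wf_graph H \<longrightarrow> f H = 0)" for f
    using that edge_elimination_unique by (auto simp: fun_eq_iff)
qed

theorem edge_elimination_xi: "edge_elimination x y z (\<lambda>G. \<xi> G x y z)"
  using theI'[OF edge_elimination_ex1[of x y z]] unfolding \<xi>_def by simp

end

theory Submission
  imports Defs
begin

text \<open>
  Eliminating the last edge of a path gives the linear recurrence
  \<open>\<xi>(P\<^sub>n\<^sub>+\<^sub>2) = (x + y) \<xi>(P\<^sub>n\<^sub>+\<^sub>1) + z \<xi>(P\<^sub>n)\<close>, whose characteristic polynomial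
  \<open>t\<^sup>2 - (x + y) t - z\<close> has discriminant \<open>D\<close>. The three cases are those of two real roots, of two
  conjugate roots \<open>sqrt (- z) (cos \<phi> \<plusminus> \<i> sin \<phi>)\<close>, and of a double root.
\<close>

lemma wf_path_graph: "wf_graph (path_graph n)"
  by (auto simp: wf_graph_def path_graph_def)

lemma path_graph_Suc_Suc:
  "path_graph (Suc (Suc n)) =
     \<lparr>verts = {..<Suc (Suc n)}, edges = add_mset (Upair n (Suc n)) (edges (path_graph (Suc n)))\<rparr>"
  by (simp add: path_graph_def lessThan_Suc)

text \<open>The vertex split off is \<open>Suc n\<close>, so it is only isomorphic, not equal, to
  \<open>path_graph 1\<close>; the recurrence below therefore uses isomorphism invariance.\<close>

lemma del_edge_path_graph:
  "del_edge (path_graph (Suc (Suc n))) (Upair n (Suc n)) =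
     graph_union \<lparr>verts = {Suc n}, edges = {#}\<rparr> (path_graph (Suc n))"
  by (auto simp: path_graph_Suc_Suc del_edge_def graph_union_def) (auto simp: path_graph_def)

text \<open>This is an equality of graphs because \<open>merge\<close> keeps the smaller endpoint
  \<open>n\<close>, exactly the last vertex of the shorter path.\<close>

lemma contract_edge_path_graph:
  "contract_edge (path_graph (Suc (Suc n))) (Upair n (Suc n)) = path_graph (Suc n)"
proof -
  let ?m = "merge (Upair n (Suc n))"
  have m: "?m v = v" if "v \<le> n" for v
    using that by (auto simp: merge_def)
  moreover have "?m (Suc n) = n"
    by (simp add: merge_def)
  ultimately have "?m ` {..<Suc (Suc n)} = {..<Suc n}"
    by (force simp: image_iff less_Suc_eq_le le_Suc_eq)
  moreover have "image_mset (map_uprod ?m) (edges (path_graph (Suc n))) =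
      image_mset id (edges (path_graph (Suc n)))"
    using wf_path_graph[of "Suc n"] unfolding wf_graph_def
    by (intro image_mset_cong) (auto simp: path_graph_def m)
  ultimately show ?thesis
    by (simp add: path_graph_Suc_Suc contract_edge_def) (simp add: path_graph_def)
qed

lemma extract_edge_path_graph:
  "extract_edge (path_graph (Suc (Suc n))) (Upair n (Suc n)) = path_graph n"
proof -
  \<comment> \<open>Besides the extracted edge, only the edge with index \<open>n - 1\<close> meets
    \<open>n\<close>. For \<open>n = 0\<close> both sides are empty, so truncated subtraction is
    harmless.\<close>
  have "{i. i < n \<and> i \<noteq> n \<and> Suc i \<noteq> n} = {..<n - 1}"
    by auto
  moreover have "{..<Suc (Suc n)} - {n, Suc n} = {..<n}"
    by auto
  ultimately show ?thesis
    by (simp add: path_graph_Suc_Suc extract_edge_def)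
      (auto simp: path_graph_def filter_mset_image_mset filter_mset_mset_set
        intro!: arg_cong[of _ _ "\<lambda>A. image_mset _ (mset_set A)"])
qed

context
  fixes x y z :: real and p :: "nat \<Rightarrow> real"
  defines "p \<equiv> \<lambda>n. \<xi> (path_graph n) x y z"
begin

lemma xi_path_0: "p 0 = 1"
  and xi_path_1: "p (Suc 0) = x"
  using edge_elimination_xi[of x y z] by (simp_all add: edge_elimination_def p_def)

text \<open>Deletion contributes \<open>x * p (Suc n)\<close>, the factor \<open>x\<close> coming
  from the isolated vertex; contraction contributes \<open>y * p (Suc n)\<close> and extraction
  \<open>z * p n\<close>.\<close>

lemma xi_path_Suc_Suc: "p (Suc (Suc n)) = (x + y) * p (Suc n) + z * p n"
proof -
  let ?G = "path_graph (Suc (Suc n))" and ?e = "Upair n (Suc n)"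
  let ?A = "\<lparr>verts = {Suc n}, edges = {#}\<rparr>" and ?f = "\<lambda>G. \<xi> G x y z"
  have iso: "?f G = ?f H" if "wf_graph G" "wf_graph H" "G \<cong>\<^sub>g H" for G H
    using edge_elimination_xi[of x y z] that by (simp add: edge_elimination_def)
  have elim: "?f G = ?f (del_edge G e) + y * ?f (contract_edge G e) + z * ?f (extract_edge G e)"
    if "wf_graph G" "e \<in># edges G" for G e
    using edge_elimination_xi[of x y z] that unfolding edge_elimination_def by blast
  have union: "?f (graph_union G H) = ?f G * ?f H"
    if "wf_graph G" "wf_graph H" "verts G \<inter> verts H = {}" for G H
    using edge_elimination_xi[of x y z] that by (simp add: edge_elimination_def)
  have wfA: "wf_graph ?A"
    by (simp add: wf_graph_def)
  have "?A \<cong>\<^sub>g path_graph 1"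
    by (auto simp: graph_iso_def path_graph_def bij_betw_def intro!: exI[of _ "\<lambda>_. 0"])
  then have "?f ?A = x"
    using iso[OF wfA wf_path_graph] xi_path_1 by (simp add: p_def)
  moreover have "verts ?A \<inter> verts (path_graph (Suc n)) = {}"
    by (simp add: path_graph_def)
  ultimately have "?f (del_edge ?G ?e) = x * p (Suc n)"
    using union[OF wfA wf_path_graph] by (simp add: del_edge_path_graph p_def)
  moreover have "?e \<in># edges ?G"
    by (simp add: path_graph_Suc_Suc)
  note elim[OF wf_path_graph this]
  ultimately show ?thesis
    by (simp add: p_def contract_edge_path_graph extract_edge_path_graph algebra_simps)
qed

lemma xi_path_eqI:
  assumes "q 0 = 1" "q (Suc 0) = x"
    and "\<And>n. q (Suc (Suc n)) = (x + y) * q (Suc n) + z * q n"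
  shows "p n = q n"
  by (induction n rule: induct_nat_012) (simp_all add: assms xi_path_0 xi_path_1 xi_path_Suc_Suc)

text \<open>The bases are the two characteristic roots; the coefficients are forced by the values 1
  at index 0 and \<open>x\<close> at index 1.\<close>

lemma xi_path_real_roots:
  assumes "s \<noteq> 0" and s: "s\<^sup>2 = (x + y)\<^sup>2 + 4 * z"
  shows "p n = (s - x + y) / (2 * s) * ((x + y - s) / 2) ^ n
             + (s + x - y) / (2 * s) * ((x + y + s) / 2) ^ n"
proof (rule xi_path_eqI)
  let ?a = "(x + y - s) / 2" and ?b = "(x + y + s) / 2"
  have root: "?a\<^sup>2 = (x + y) * ?a + z" "?b\<^sup>2 = (x + y) * ?b + z"
    using s by (simp_all add: power2_eq_square field_simps)
  show "(s - x + y) / (2 * s) * ?a ^ Suc (Suc k) + (s + x - y) / (2 * s) * ?b ^ Suc (Suc k) =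
      (x + y) * ((s - x + y) / (2 * s) * ?a ^ Suc k + (s + x - y) / (2 * s) * ?b ^ Suc k)
      + z * ((s - x + y) / (2 * s) * ?a ^ k + (s + x - y) / (2 * s) * ?b ^ k)" for k
  proof -
    \<comment> \<open>By linearity each geometric sequence can be treated separately.\<close>
    have "c * t ^ Suc (Suc k) = (x + y) * (c * t ^ Suc k) + z * (c * t ^ k)"
      if "t\<^sup>2 = (x + y) * t + z" for c t
    proof -
      have "c * t ^ Suc (Suc k) = c * t ^ k * t\<^sup>2"
        by (simp add: power2_eq_square)
      then show ?thesis
        unfolding that by (simp add: algebra_simps)
    qed
    from this[OF root(1), of "(s - x + y) / (2 * s)"] this[OF root(2), of "(s + x - y) / (2 * s)"]
    show ?thesis
      by (simp only: distrib_left)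
  qed
qed (use assms(1) in \<open>simp_all add: field_simps\<close>)

text \<open>The conjugate roots have modulus \<open>\<bar>r\<bar>\<close>, sum \<open>x + y\<close>
  and product \<open>- z\<close>; real and imaginary parts of their powers replace complex numbers.
  The sine coefficient is forced by the value \<open>x\<close> at index 1.\<close>

lemma xi_path_complex_roots:
  assumes "s \<noteq> 0" and xy: "x + y = 2 * r * cos \<phi>" and s: "s = 2 * r * sin \<phi>" and z: "z = - r\<^sup>2"
  shows "p n = r ^ n * (cos (real n * \<phi>) + (x - y) / s * sin (real n * \<phi>))"
proof (rule xi_path_eqI)
  have "(x - y) / s * (r * sin \<phi>) = (x - y) / 2"
    using assms(1) s by (simp add: field_simps)
  moreover have "r * cos \<phi> = (x + y) / 2"
    using xy by simp
  ultimately have "r * cos \<phi> + (x - y) / s * (r * sin \<phi>) = x"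
    by (simp only:) (simp add: field_simps)
  then show "r ^ Suc 0 * (cos (real (Suc 0) * \<phi>) + (x - y) / s * sin (real (Suc 0) * \<phi>)) = x"
    by (simp add: distrib_left mult.left_commute)
  show "r ^ Suc (Suc k) * (cos (real (Suc (Suc k)) * \<phi>) + (x - y) / s * sin (real (Suc (Suc k)) * \<phi>)) =
      (x + y) * (r ^ Suc k * (cos (real (Suc k) * \<phi>) + (x - y) / s * sin (real (Suc k) * \<phi>)))
      + z * (r ^ k * (cos (real k * \<phi>) + (x - y) / s * sin (real k * \<phi>)))" for k
  proof -
    \<comment> \<open>Centred at the middle angle \<open>t\<close>, the recurrence reduces to cos(t
      + \<phi>) + cos(t - \<phi>) = 2 cos t cos \<phi> and its sine analogue.\<close>
    define t c where "t = real (Suc k) * \<phi>" and "c = (x - y) / s"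
    have t: "real (Suc (Suc k)) * \<phi> = t + \<phi>" "real k * \<phi> = t - \<phi>"
      by (simp_all add: t_def algebra_simps)
    show ?thesis
      unfolding t t_def[symmetric] c_def[symmetric] xy z
      by (simp add: cos_add cos_diff sin_add sin_diff power2_eq_square algebra_simps)
  qed
qed simp

text \<open>At \<open>n = 0\<close> the truncated exponent would give \<open>(x + y) / 2\<close>
  instead of 1, so the induction starts at index 1 and \<open>xi_path_eqI\<close> does not
  apply.\<close>

lemma xi_path_double_root:
  assumes "n > 0" "z = - ((x + y) / 2)\<^sup>2"
  shows "p n = ((real n + 1) * x - (real n - 1) * y) / 2 * ((x + y) / 2) ^ (n - 1)"
proof -
  have "p (Suc k) = ((real k + 2) * x - real k * y) / 2 * ((x + y) / 2) ^ k" for k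
  proof (induction k rule: induct_nat_012)
    case (ge2 k)
    define c where "c = (x + y) / 2"
    have c: "x + y = 2 * c" "z = - c\<^sup>2"
      using assms(2) by (simp_all add: c_def)
    show ?case
      unfolding xi_path_Suc_Suc[of "Suc k"] ge2 c_def[symmetric] unfolding c
      by (simp add: power2_eq_square field_simps)
  qed (use assms(2) in \<open>simp_all add: xi_path_0 xi_path_1 xi_path_Suc_Suc power2_eq_square field_simps\<close>)
  from this[of "n - 1"] assms(1) show ?thesis
    by (simp add: of_nat_diff algebra_simps)
qed

end

text \<open>\<phi> is the argument in (0, pi) of the point (a, b) of the upper half plane;
  \<open>arctan\<close> alone reaches only the right half, hence the shift by \<open>pi\<close> for
  negative \<open>a\<close>.\<close>

lemma polar_arctan:
  fixes a b :: real
  assumes "b > 0"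
    and \<phi>: "\<phi> = (if a > 0 then arctan (b / a) else if a = 0 then pi / 2 else pi + arctan (b / a))"
  shows "a = sqrt (a\<^sup>2 + b\<^sup>2) * cos \<phi>" and "b = sqrt (a\<^sup>2 + b\<^sup>2) * sin \<phi>"
proof -
  have "a = sqrt (a\<^sup>2 + b\<^sup>2) * cos \<phi> \<and> b = sqrt (a\<^sup>2 + b\<^sup>2) * sin \<phi>"
  proof (cases "a = 0")
    case True
    have "\<phi> = pi / 2"
      using \<phi> True by simp
    show ?thesis
      using True \<open>b > 0\<close> unfolding \<open>\<phi> = pi / 2\<close> by simp
  next
    case False
    then have "1 + (b / a)\<^sup>2 = (a\<^sup>2 + b\<^sup>2) / a\<^sup>2"
      by (simp add: field_simps)
    \<comment> \<open>This root is the denominator in \<open>cos_arctan\<close> and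
      \<open>sin_arctan\<close>. For negative \<open>a\<close> the sign from the absolute value
      cancels the one from the shift by \<open>pi\<close>.\<close>
    then have "sqrt (1 + (b / a)\<^sup>2) = sqrt (a\<^sup>2 + b\<^sup>2) / \<bar>a\<bar>"
      by (simp add: real_sqrt_divide)
    moreover have "sqrt (a\<^sup>2 + b\<^sup>2) \<noteq> 0"
      using False by (simp add: sum_power2_eq_zero_iff)
    ultimately show ?thesis
      using False by (auto simp: \<phi> cos_arctan sin_arctan)
  qed
  then show "a = sqrt (a\<^sup>2 + b\<^sup>2) * cos \<phi>" and "b = sqrt (a\<^sup>2 + b\<^sup>2) * sin \<phi>"
    by blast+
qed

theorem theorem1:
  fixes n :: nat and x y z D \<phi> :: real
  assumes n: "n > 0"
    and D: "D = x\<^sup>2 + 2 * x * y + y\<^sup>2 + 4 * z"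
    and \<phi>: "\<phi> = (if x + y > 0 then arctan (sqrt (- D) / (x + y))
                 else if x + y = 0 then pi / 2
                 else pi + arctan (sqrt (- D) / (x + y)))"
  shows "(z > - ((x + y) / 2)\<^sup>2 \<longrightarrow>
            \<xi> (path_graph n) x y z =
              (sqrt D - x + y) / (2 * sqrt D) * ((x + y - sqrt D) / 2) ^ n
              + (sqrt D + x - y) / (2 * sqrt D) * ((x + y + sqrt D) / 2) ^ n)
       \<and> (z < - ((x + y) / 2)\<^sup>2 \<longrightarrow>
            \<xi> (path_graph n) x y z =
              (- z) powr (real n / 2)
              * (cos (real n * \<phi>) + (x - y) / sqrt (- D) * sin (real n * \<phi>)))
       \<and> (z = - ((x + y) / 2)\<^sup>2 \<longrightarrow>
            \<xi> (path_graph n) x y z =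
              ((real n + 1) * x - (real n - 1) * y) / 2 * ((x + y) / 2) ^ (n - 1))"
proof (intro conjI impI)
  \<comment> \<open>In this form D is four times \<open>z + ((x + y) / 2)\<^sup>2\<close>, so its
    sign separates the cases.\<close>
  have D': "D = (x + y)\<^sup>2 + 4 * z"
    using D by (simp add: power2_eq_square algebra_simps)
  have half: "((x + y) / 2)\<^sup>2 = (x + y)\<^sup>2 / 4"
    by (simp add: power_divide)
  {
    assume "z > - ((x + y) / 2)\<^sup>2"
    then have "D > 0"
      unfolding D' half by simp
    then show "\<xi> (path_graph n) x y z =
        (sqrt D - x + y) / (2 * sqrt D) * ((x + y - sqrt D) / 2) ^ n
        + (sqrt D + x - y) / (2 * sqrt D) * ((x + y + sqrt D) / 2) ^ n"
      by (intro xi_path_real_roots) (simp_all add: D')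
  next
    assume z: "z < - ((x + y) / 2)\<^sup>2"
    then have "D < 0"
      unfolding D' half by simp
    have "z < 0"
      using z zero_le_power2[of "(x + y) / 2"] by linarith
    have "(x + y)\<^sup>2 + (sqrt (- D))\<^sup>2 = 2\<^sup>2 * (- z)"
      using \<open>D < 0\<close> by (simp add: D')
    \<comment> \<open>The point (x + y, sqrt(-D)) represents twice a characteristic root, which
      gives modulus \<open>sqrt (- z)\<close> for the root itself.\<close>
    then have R: "sqrt ((x + y)\<^sup>2 + (sqrt (- D))\<^sup>2) = 2 * sqrt (- z)"
      by (simp only: real_sqrt_mult real_sqrt_abs abs_numeral)
    have s: "sqrt (- D) > 0"
      using \<open>D < 0\<close> by simp
    have "\<xi> (path_graph n) x y z =
        sqrt (- z) ^ n * (cos (real n * \<phi>) + (x - y) / sqrt (- D) * sin (real n * \<phi>))"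
      using s \<open>z < 0\<close>
      by (intro xi_path_complex_roots polar_arctan[OF s \<phi>, unfolded R]) simp_all
    moreover have "sqrt (- z) ^ n = (- z) powr (real n / 2)"
      using \<open>z < 0\<close> by (simp add: powr_half_sqrt[symmetric] powr_power)
    ultimately show "\<xi> (path_graph n) x y z =
        (- z) powr (real n / 2) * (cos (real n * \<phi>) + (x - y) / sqrt (- D) * sin (real n * \<phi>))"
      by simp
  next
    assume "z = - ((x + y) / 2)\<^sup>2"
    then show "\<xi> (path_graph n) x y z =
        ((real n + 1) * x - (real n - 1) * y) / 2 * ((x + y) / 2) ^ (n - 1)"
      by (rule xi_path_double_root[OF n])
  }
qed

end
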